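(* Let $A$, $B$ and $\mathcal{C}$ be Banach algebras and let $T:B\to A$ be an algebra homomorphism with $\|T\|\le 1$. Let $A\times_T B$ be the $T$-Lau product algebra. (1) Suppose $A$ is a Banach left $\mathcal{C}$-module, and regard $A\times_T B$ as a Banach left $\mathcal{C}$-module via $c\cdot(a,b)=(c\cdot a+c\cdot T(b),0)$. If $A\times_T B$ is injective as a Banach left $\mathcal{C}$-module, then $A$ is injective as a Banach left $\mathcal{C}$-module. (2) Suppose $B$ is a Banach left $\mathcal{C}$-module, and regard $A\times_T B$ as a Banach left $\mathcal{C}$-module via $c\cdot(a,b)=(-T(c\cdot b),c\cdot b)$. If $A\times_T B$ is injective as a Banach left $\mathcal{C}$-module, then $B$ is injective as a Banach left $\mathcal{C}$-module.
   Context: The $T$-Lau product algebra $A\times_T B$ is the Cartesian product $A\times B$ with multiplication $(a,b)\times_T(c,d)=(ac+T(b)c+aT(d),\,bd)$ and norm $\|(a,b)\|=\|a\|+\|b\|$; it is a Banach algebra. For a Banach algebra $\mathcal{C}$ and Banach left $\mathcal{C}$-modules $E,F$ (module actions are bounded bilinear maps), $B(E,F)$ is the space of bounded linear operators $E\to F$ and ${}_{\mathcal{C}}B(E,F)$ is the subspace of bounded left $\mathcal{C}$-module morphisms. An operator $S\in B(E,F)$ is admissible if there is $S'\in B(F,E)$ with $S\circ S'\circ S=S$. A Banach left $\mathcal{C}$-module $K$ is injective if for all Banach left $\mathcal{C}$-modules $E,F$ and every admissible monomorphism (injective morphism) $S\in{}_{\mathcal{C}}B(E,F)$, the map ${}_{\mathcal{C}}B(F,K)\to{}_{\mathcal{C}}B(E,K)$,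 $R\mapsto R\circ S$, is surjective. *)

theory Defs
  imports Complex_Main "HOL-Algebra.Algebraic_Closure_Type"
begin

text \<open>
  Spaces and algebras have explicit carriers, so that one can quantify over all Banach modules
  inside a formula (see \<open>injective_module\<close> below).  The scalars are a complete normed field
  \<open>'k\<close> with multiplicative norm, that is, the real or the complex numbers.
  In the records the field \<open>one\<close> is never used and \<open>mult\<close> is used for algebras only;
  algebras need not be unital.
\<close>

abbreviation scalars :: "'k::{real_normed_field,banach} ring" where
  "scalars \<equiv> ring_of_type_algebra"

record ('k, 'v) normed_space = "('k, 'v) module" +
  nrm :: "'v \<Rightarrow> real"

locale banach_space = Module.module scalars V
  for V :: "('k::{real_normed_field,banach}, 'v) normed_space" (structure) +
  assumes nrm_nonneg: "x \<in> carrier V \<Longrightarrow> 0 \<le> nrm V x"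
    and nrm_eq_zero: "x \<in> carrier V \<Longrightarrow> nrm V x = 0 \<longleftrightarrow> x = \<zero>"
    and nrm_triangle: "x \<in> carrier V \<Longrightarrow> y \<in> carrier V \<Longrightarrow> nrm V (x \<oplus> y) \<le> nrm V x + nrm V y"
    and nrm_smult: "x \<in> carrier V \<Longrightarrow> nrm V (k \<odot>\<^bsub>V\<^esub> x) = norm k * nrm V x"
    and complete: "range s \<subseteq> carrier V
      \<Longrightarrow> \<forall>e>0. \<exists>N. \<forall>m\<ge>N. \<forall>n\<ge>N. nrm V (s m \<ominus> s n) < e
      \<Longrightarrow> \<exists>x\<in>carrier V. (\<lambda>n. nrm V (s n \<ominus> x)) \<longlonglongrightarrow> 0"

definition linear_op ::
  "('k::{real_normed_field,banach}, 'v) normed_space \<Rightarrow> ('k, 'w) normed_space \<Rightarrow> ('v \<Rightarrow> 'w) \<Rightarrow> bool" where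
  "linear_op V W f \<longleftrightarrow>
     f \<in> carrier V \<rightarrow> carrier W \<and>
     (\<forall>x\<in>carrier V. \<forall>y\<in>carrier V. f (x \<oplus>\<^bsub>V\<^esub> y) = f x \<oplus>\<^bsub>W\<^esub> f y) \<and>
     (\<forall>k. \<forall>x\<in>carrier V. f (k \<odot>\<^bsub>V\<^esub> x) = k \<odot>\<^bsub>W\<^esub> f x)"

definition bounded_op ::
  "('k::{real_normed_field,banach}, 'v) normed_space \<Rightarrow> ('k, 'w) normed_space \<Rightarrow> ('v \<Rightarrow> 'w) \<Rightarrow> bool" where
  "bounded_op V W f \<longleftrightarrow>
     linear_op V W f \<and> (\<exists>M. \<forall>x\<in>carrier V. nrm W (f x) \<le> M * nrm V x)"

definition op_norm ::
  "('k::{real_normed_field,banach}, 'v) normed_space \<Rightarrow> ('k, 'w) normed_space \<Rightarrow> ('v \<Rightarrow> 'w) \<Rightarrow> real" where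
  "op_norm V W f = (SUP x\<in>{x \<in> carrier V. nrm V x \<le> 1}. nrm W (f x))"

definition bilinear_op ::
  "('k::{real_normed_field,banach}, 'u) normed_space \<Rightarrow> ('k, 'v) normed_space \<Rightarrow> ('k, 'w) normed_space
    \<Rightarrow> ('u \<Rightarrow> 'v \<Rightarrow> 'w) \<Rightarrow> bool" where
  "bilinear_op U V W f \<longleftrightarrow>
     (\<forall>x\<in>carrier U. linear_op V W (f x)) \<and> (\<forall>y\<in>carrier V. linear_op U W (\<lambda>x. f x y))"

locale banach_algebra = banach_space A
  for A :: "('k::{real_normed_field,banach}, 'a) normed_space" (structure) +
  assumes mult_bilinear: "bilinear_op A A A (\<otimes>)"
    and mult_assoc: "x \<in> carrier A \<Longrightarrow> y \<in> carrier A \<Longrightarrow> z \<in> carrier A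
      \<Longrightarrow> (x \<otimes> y) \<otimes> z = x \<otimes> (y \<otimes> z)"
    and nrm_mult: "x \<in> carrier A \<Longrightarrow> y \<in> carrier A \<Longrightarrow> nrm A (x \<otimes> y) \<le> nrm A x * nrm A y"

definition algebra_hom ::
  "('k::{real_normed_field,banach}, 'b) normed_space \<Rightarrow> ('k, 'a) normed_space \<Rightarrow> ('b \<Rightarrow> 'a) \<Rightarrow> bool" where
  "algebra_hom B A T \<longleftrightarrow>
     linear_op B A T \<and>
     (\<forall>x\<in>carrier B. \<forall>y\<in>carrier B. T (x \<otimes>\<^bsub>B\<^esub> y) = T x \<otimes>\<^bsub>A\<^esub> T y)"

definition T_Lau ::
  "('k::{real_normed_field,banach}, 'a) normed_space \<Rightarrow> ('k, 'b) normed_space \<Rightarrow> ('b \<Rightarrow> 'a)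
    \<Rightarrow> ('k, 'a \<times> 'b) normed_space" where
  "T_Lau A B T =
     \<lparr>carrier = carrier A \<times> carrier B,
      monoid.mult = (\<lambda>(a, b) (c, d). (a \<otimes>\<^bsub>A\<^esub> c \<oplus>\<^bsub>A\<^esub> T b \<otimes>\<^bsub>A\<^esub> c \<oplus>\<^bsub>A\<^esub> a \<otimes>\<^bsub>A\<^esub> T d, b \<otimes>\<^bsub>B\<^esub> d)),
      one = undefined,
      ring.zero = (\<zero>\<^bsub>A\<^esub>, \<zero>\<^bsub>B\<^esub>),
      add = (\<lambda>(a, b) (c, d). (a \<oplus>\<^bsub>A\<^esub> c, b \<oplus>\<^bsub>B\<^esub> d)),
      module.smult = (\<lambda>k (a, b). (k \<odot>\<^bsub>A\<^esub> a, k \<odot>\<^bsub>B\<^esub> b)),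
      nrm = (\<lambda>(a, b). nrm A a + nrm B b)\<rparr>"

locale left_banach_module = C: banach_algebra C + E: banach_space E
  for C :: "('k::{real_normed_field,banach}, 'c) normed_space"
    and E :: "('k, 'v) normed_space" and act :: "'c \<Rightarrow> 'v \<Rightarrow> 'v" +
  assumes act_bilinear: "bilinear_op C E E act"
    and act_bounded:
      "\<exists>M. \<forall>c\<in>carrier C. \<forall>x\<in>carrier E. nrm E (act c x) \<le> M * nrm C c * nrm E x"
    and act_assoc: "c \<in> carrier C \<Longrightarrow> d \<in> carrier C \<Longrightarrow> x \<in> carrier E
      \<Longrightarrow> act (c \<otimes>\<^bsub>C\<^esub> d) x = act c (act d x)"

text \<open>
  Operators are extensional functions, so that equality of operators is equality of functions
  and composition is \<^const>\<open>compose\<close>.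
\<close>

definition bounded_ops ::
  "('k::{real_normed_field,banach}, 'v) normed_space \<Rightarrow> ('k, 'w) normed_space \<Rightarrow> ('v \<Rightarrow> 'w) set" where
  "bounded_ops E F = {S \<in> extensional (carrier E). bounded_op E F S}"

definition module_ops ::
  "('k::{real_normed_field,banach}, 'c) normed_space
    \<Rightarrow> ('k, 'v) normed_space \<Rightarrow> ('c \<Rightarrow> 'v \<Rightarrow> 'v)
    \<Rightarrow> ('k, 'w) normed_space \<Rightarrow> ('c \<Rightarrow> 'w \<Rightarrow> 'w) \<Rightarrow> ('v \<Rightarrow> 'w) set" where
  "module_ops C E actE F actF =
     {S \<in> bounded_ops E F. \<forall>c\<in>carrier C. \<forall>x\<in>carrier E. S (actE c x) = actF c (S x)}"

definition admissible ::
  "('k::{real_normed_field,banach}, 'v) normed_space \<Rightarrow> ('k, 'w) normed_space \<Rightarrow> ('v \<Rightarrow> 'w) \<Rightarrow> bool" where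
  "admissible E F S \<longleftrightarrow>
     (\<exists>S'\<in>bounded_ops F E. compose (carrier E) S (compose (carrier E) S' S) = S)"

text \<open>
  The test modules \<open>E\<close>, \<open>F\<close> range over all Banach left \<open>C\<close>-modules whose carrier is a set of
  elements of the type \<open>'u\<close>.  HOL cannot quantify over types inside a formula; \<open>'u\<close>
  plays the role of a universe, and statements are to be read as holding for every \<open>'u\<close>.
\<close>

definition injective_module ::
  "'u itself \<Rightarrow> ('k::{real_normed_field,banach}, 'c) normed_space
    \<Rightarrow> ('k, 'w) normed_space \<Rightarrow> ('c \<Rightarrow> 'w \<Rightarrow> 'w) \<Rightarrow> bool" where
  "injective_module (U :: 'u itself) C K actK \<longleftrightarrow>
     left_banach_module C K actK \<and>
     (\<forall>(E :: ('k, 'u) normed_space) actE (F :: ('k, 'u) normed_space) actF S.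
        left_banach_module C E actE \<longrightarrow> left_banach_module C F actF \<longrightarrow>
        S \<in> module_ops C E actE F actF \<longrightarrow> inj_on S (carrier E) \<longrightarrow> admissible E F S \<longrightarrow>
        (\<lambda>R. compose (carrier E) R S) ` module_ops C F actF K actK = module_ops C E actE K actK)"

end

theory Submission
  imports Defs
begin

text \<open>
  Injectivity passes to retracts: if \<open>K\<close> is a direct factor of an injective module \<open>L\<close> through
  morphisms \<open>i\<close> from \<open>K\<close> to \<open>L\<close> and \<open>p\<close> from \<open>L\<close> to \<open>K\<close> with \<open>p \<circ> i = id\<close>, then a morphism into
  \<open>K\<close> is extended by pushing it into \<open>L\<close> with \<open>i\<close>, extending it there, and projecting back with \<open>p\<close>
  (\<open>injective_module_retract\<close>).

  Both module structures on the \<open>T\<close>-Lau product come from such a retraction.  The shear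
  \<open>(a, b) \<mapsto> (a + T b, b)\<close> carries the action of the first part to the one that is the
  given action on \<open>A\<close> and zero on \<open>B\<close>, and the action of the second part to the one that is
  zero on \<open>A\<close> and the given action on \<open>B\<close>.  Undoing the shear turns the coordinate inclusions
  and projections of the direct sum into
  \<open>a \<mapsto> (a, 0)\<close> and \<open>(a, b) \<mapsto> a + T b\<close> for \<open>A\<close>, and
  \<open>b \<mapsto> (- T b, b)\<close> and \<open>(a, b) \<mapsto> b\<close> for \<open>B\<close>.
  These maps are bounded because \<open>T\<close> is.
\<close>

section \<open>Module morphisms and retracts of injective modules\<close>

lemma linear_op_cong:
  assumes "banach_space V" and "linear_op V W f" and "\<And>x. x \<in> carrier V \<Longrightarrow> f x = g x"
  shows "linear_op V W g"
proof -
  interpret V: banach_space V by fact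
  have "k \<odot>\<^bsub>V\<^esub> x \<in> carrier V" if "x \<in> carrier V" for k x
    using that V.smult_closed[of k x] by (simp add: ring_of_type_algebra_def)
  with assms show ?thesis
    unfolding linear_op_def by (auto simp: Pi_iff)
qed

lemma bounded_op_cong:
  assumes "banach_space V" and "bounded_op V W f" and "\<And>x. x \<in> carrier V \<Longrightarrow> f x = g x"
  shows "bounded_op V W g"
  using assms linear_op_cong[OF assms(1) _ assms(3)] unfolding bounded_op_def by fastforce

lemma bounded_op_comp:
  assumes "banach_space V" and "bounded_op U V f" and "bounded_op V W g"
  shows "bounded_op U W (\<lambda>x. g (f x))"
proof -
  interpret V: banach_space V by fact
  obtain M where M: "\<And>x. x \<in> carrier U \<Longrightarrow> nrm V (f x) \<le> M * nrm U x"
    using assms unfolding bounded_op_def by blast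
  obtain N where N: "\<And>y. y \<in> carrier V \<Longrightarrow> nrm W (g y) \<le> N * nrm V y"
    using assms unfolding bounded_op_def by blast
  have f: "f x \<in> carrier V" if "x \<in> carrier U" for x
    using assms that unfolding bounded_op_def linear_op_def by auto
  \<comment> \<open>A bound \<open>N\<close> may be negative when the source is the zero space; \<open>\<bar>N\<bar>\<close> keeps monotonicity.\<close>
  have "nrm W (g (f x)) \<le> (\<bar>N\<bar> * M) * nrm U x" if x: "x \<in> carrier U" for x
  proof -
    have "nrm W (g (f x)) \<le> N * nrm V (f x)"
      using N f x by blast
    also have "\<dots> \<le> \<bar>N\<bar> * nrm V (f x)"
      by (intro mult_right_mono V.nrm_nonneg f x) simp
    also have "\<dots> \<le> \<bar>N\<bar> * (M * nrm U x)"
      by (intro mult_left_mono M x) simp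
    finally show ?thesis by (simp add: mult.assoc)
  qed
  moreover have "linear_op U W (\<lambda>x. g (f x))"
    using assms unfolding bounded_op_def linear_op_def by (auto simp: Pi_iff)
  ultimately show ?thesis
    unfolding bounded_op_def by blast
qed

lemma module_ops_funcset: "S \<in> module_ops C E actE F actF \<Longrightarrow> S \<in> carrier E \<rightarrow> carrier F"
  unfolding module_ops_def bounded_ops_def bounded_op_def linear_op_def by blast

lemma left_banach_module_act_closed:
  assumes "left_banach_module C E act" "c \<in> carrier C" "x \<in> carrier E"
  shows "act c x \<in> carrier E"
  using left_banach_module.act_bilinear[OF assms(1)] assms(2,3)
  unfolding bilinear_op_def linear_op_def by auto

lemma restrict_in_module_ops:
  assumes "left_banach_module C E actE" and "bounded_op E F f"
    and "\<And>c x. c \<in> carrier C \<Longrightarrow> x \<in> carrier E \<Longrightarrow> f (actE c x) = actF c (f x)"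
  shows "restrict f (carrier E) \<in> module_ops C E actE F actF"
proof -
  have "banach_space E"
    using assms(1) by (simp add: left_banach_module_def)
  then have "bounded_op E F (restrict f (carrier E))"
    by (rule bounded_op_cong[OF _ assms(2)]) simp
  then show ?thesis
    using assms(3) left_banach_module_act_closed[OF assms(1)]
    unfolding module_ops_def bounded_ops_def by auto
qed

lemma module_ops_compose:
  assumes E: "left_banach_module C E actE" and F: "left_banach_module C F actF"
    and S: "S \<in> module_ops C E actE F actF" and R: "R \<in> module_ops C F actF G actG"
  shows "compose (carrier E) R S \<in> module_ops C E actE G actG"
proof -
  have "banach_space F"
    using F by (simp add: left_banach_module_def)
  then have "bounded_op E G (\<lambda>x. R (S x))"
    using S R unfolding module_ops_def bounded_ops_def by (blast intro: bounded_op_comp)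
  moreover have "R (S (actE c x)) = actG c (R (S x))" if "c \<in> carrier C" "x \<in> carrier E" for c x
  proof -
    have "S (actE c x) = actF c (S x)"
      using S that unfolding module_ops_def by blast
    moreover have "R (actF c (S x)) = actG c (R (S x))"
      using R that(1) funcset_mem[OF module_ops_funcset[OF S] that(2)]
      unfolding module_ops_def by blast
    ultimately show ?thesis by simp
  qed
  ultimately show ?thesis
    unfolding compose_def by (intro restrict_in_module_ops E) auto
qed

text \<open>
  Besides the stability under composition, which gives one inclusion of the image, the point is:
  a morphism \<open>R\<close> into \<open>K\<close> is recovered from an extension \<open>Q\<close> of \<open>i \<circ> R\<close>, since
  \<open>p \<circ> Q\<close> restricts to \<open>p \<circ> i \<circ> R = R\<close>.
\<close>

lemma injective_module_retract:
  fixes C :: "('k::{real_normed_field,banach}, 'c) normed_space"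
  assumes L: "injective_module TYPE('u) C L actL" and K: "left_banach_module C K actK"
    and i: "i \<in> module_ops C K actK L actL" and p: "p \<in> module_ops C L actL K actK"
    and pi: "\<And>x. x \<in> carrier K \<Longrightarrow> p (i x) = x"
  shows "injective_module TYPE('u) C K actK"
  unfolding injective_module_def
proof (intro conjI allI impI K)
  fix E F :: "('k, 'u) normed_space" and actE actF S
  assume E: "left_banach_module C E actE" and F: "left_banach_module C F actF"
    and S: "S \<in> module_ops C E actE F actF" and "inj_on S (carrier E)" "admissible E F S"
  then have ext: "(\<lambda>R. compose (carrier E) R S) ` module_ops C F actF L actL
      = module_ops C E actE L actL"
    using L unfolding injective_module_def by blast
  have L': "left_banach_module C L actL"
    using L unfolding injective_module_def by blast
  show "(\<lambda>R. compose (carrier E) R S) ` module_ops C F actF K actK = module_ops C E actE K actK"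
  proof (intro equalityI image_subsetI subsetI)
    fix R assume "R \<in> module_ops C F actF K actK"
    then show "compose (carrier E) R S \<in> module_ops C E actE K actK"
      by (rule module_ops_compose[OF E F S])
  next
    fix R assume R: "R \<in> module_ops C E actE K actK"
    have "compose (carrier E) i R \<in> module_ops C E actE L actL"
      by (rule module_ops_compose[OF E K R i])
    then obtain Q where Q: "Q \<in> module_ops C F actF L actL"
      and iR: "compose (carrier E) i R = compose (carrier E) Q S"
      unfolding ext[symmetric] by blast
    have "compose (carrier E) (compose (carrier F) p Q) S
        = compose (carrier E) p (compose (carrier E) Q S)"
      by (rule compose_assoc[OF module_ops_funcset[OF S], symmetric])
    also have "\<dots> = compose (carrier E) p (compose (carrier E) i R)"
      by (simp only: iR)
    also have "\<dots> = R"
    proof (rule extensionalityI[of _ "carrier E"])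
      show "R \<in> extensional (carrier E)"
        using R unfolding module_ops_def bounded_ops_def by blast
      show "compose (carrier E) p (compose (carrier E) i R) x = R x" if "x \<in> carrier E" for x
        using that module_ops_funcset[OF R] by (simp add: compose_eq pi Pi_iff)
    qed (rule compose_extensional)
    finally have "R = compose (carrier E) (compose (carrier F) p Q) S" ..
    moreover have "compose (carrier F) p Q \<in> module_ops C F actF K actK"
      by (rule module_ops_compose[OF F L' Q p])
    ultimately show "R \<in> (\<lambda>R. compose (carrier E) R S) ` module_ops C F actF K actK"
      by (rule image_eqI)
  qed
qed

section \<open>The two retractions of the Lau product\<close>

context
  fixes A :: "('k::{real_normed_field,banach}, 'a) normed_space"
    and B :: "('k, 'b) normed_space" and T :: "'b \<Rightarrow> 'a"
  assumes A: "banach_space A" and B: "banach_space B" and T: "bounded_op B A T"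
begin

interpretation A: banach_space A by (rule A)
interpretation B: banach_space B by (rule B)

lemma smult_closed_A: "x \<in> carrier A \<Longrightarrow> k \<odot>\<^bsub>A\<^esub> x \<in> carrier A"
  using A.smult_closed[of k x] by (simp add: ring_of_type_algebra_def)

lemma smult_distr_A:
  "x \<in> carrier A \<Longrightarrow> y \<in> carrier A \<Longrightarrow> k \<odot>\<^bsub>A\<^esub> (x \<oplus>\<^bsub>A\<^esub> y) = k \<odot>\<^bsub>A\<^esub> x \<oplus>\<^bsub>A\<^esub> k \<odot>\<^bsub>A\<^esub> y"
  using A.smult_r_distr[of k x y] by (simp add: ring_of_type_algebra_def)

lemma smult_minus_A: "x \<in> carrier A \<Longrightarrow> k \<odot>\<^bsub>A\<^esub> (\<ominus>\<^bsub>A\<^esub> x) = \<ominus>\<^bsub>A\<^esub> (k \<odot>\<^bsub>A\<^esub> x)"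
  using A.smult_r_minus[of k x] by (simp add: ring_of_type_algebra_def)

lemma smult_zero_B: "k \<odot>\<^bsub>B\<^esub> \<zero>\<^bsub>B\<^esub> = \<zero>\<^bsub>B\<^esub>"
  using B.smult_r_null[of k] by (simp add: ring_of_type_algebra_def)

lemma nrm_uminus_A:
  assumes "x \<in> carrier A" shows "nrm A (\<ominus>\<^bsub>A\<^esub> x) = nrm A x"
proof -
  have "(- 1) \<odot>\<^bsub>A\<^esub> x = \<ominus>\<^bsub>A\<^esub> x"
  proof (rule A.minus_equality[symmetric])
    show "(- 1) \<odot>\<^bsub>A\<^esub> x \<oplus>\<^bsub>A\<^esub> x = \<zero>\<^bsub>A\<^esub>"
      using assms A.smult_l_distr[of "- 1" 1 x] A.smult_one[of x] A.smult_l_null[of x]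
      by (simp add: ring_of_type_algebra_def)
  qed (use assms smult_closed_A in auto)
  then show ?thesis
    using A.nrm_smult[OF assms, of "- 1"] by simp
qed

lemma T_closed: "b \<in> carrier B \<Longrightarrow> T b \<in> carrier A"
  and T_add: "b \<in> carrier B \<Longrightarrow> d \<in> carrier B \<Longrightarrow> T (b \<oplus>\<^bsub>B\<^esub> d) = T b \<oplus>\<^bsub>A\<^esub> T d"
  and T_smult: "b \<in> carrier B \<Longrightarrow> T (k \<odot>\<^bsub>B\<^esub> b) = k \<odot>\<^bsub>A\<^esub> T b"
  using T unfolding bounded_op_def linear_op_def by auto

lemma T_bound:
  obtains M where "M \<ge> 0" and "\<And>b. b \<in> carrier B \<Longrightarrow> nrm A (T b) \<le> M * nrm B b"
proof -
  obtain M where M: "\<And>b. b \<in> carrier B \<Longrightarrow> nrm A (T b) \<le> M * nrm B b"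
    using T unfolding bounded_op_def by blast
  have "nrm A (T b) \<le> \<bar>M\<bar> * nrm B b" if "b \<in> carrier B" for b
    using M[OF that] B.nrm_nonneg[OF that] mult_right_mono[of M "\<bar>M\<bar>" "nrm B b"] by linarith
  then show thesis
    by (intro that[of "\<bar>M\<bar>"]) auto
qed

lemma bounded_op_fst_inclusion: "bounded_op A (T_Lau A B T) (\<lambda>a. (a, \<zero>\<^bsub>B\<^esub>))"
proof -
  have "nrm B \<zero>\<^bsub>B\<^esub> = 0"
    by (simp add: B.nrm_eq_zero)
  then show ?thesis
    unfolding bounded_op_def linear_op_def
    by (auto simp: T_Lau_def smult_zero_B intro!: exI[of _ 1])
qed

lemma bounded_op_sheared_fst: "bounded_op (T_Lau A B T) A (\<lambda>(a, b). a \<oplus>\<^bsub>A\<^esub> T b)"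
proof -
  obtain M where M: "M \<ge> 0" "\<And>b. b \<in> carrier B \<Longrightarrow> nrm A (T b) \<le> M * nrm B b"
    using T_bound by blast
  have "nrm A (a \<oplus>\<^bsub>A\<^esub> T b) \<le> (1 + M) * (nrm A a + nrm B b)"
    if "a \<in> carrier A" "b \<in> carrier B" for a b
  proof -
    have "nrm A (a \<oplus>\<^bsub>A\<^esub> T b) \<le> nrm A a + M * nrm B b"
      using A.nrm_triangle[of a "T b"] M(2)[of b] that T_closed by fastforce
    also have "\<dots> \<le> (1 + M) * (nrm A a + nrm B b)"
      using that M(1) A.nrm_nonneg[of a] B.nrm_nonneg[of b] by (simp add: algebra_simps)
    finally show ?thesis .
  qed
  then show ?thesis
    unfolding bounded_op_def linear_op_def
    by (auto simp: T_Lau_def T_closed T_add T_smult smult_distr_A smult_closed_A A.a_ac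
        intro!: exI[of _ "1 + M"])
qed

lemma bounded_op_sheared_snd_inclusion: "bounded_op B (T_Lau A B T) (\<lambda>b. (\<ominus>\<^bsub>A\<^esub> T b, b))"
proof -
  obtain M where M: "M \<ge> 0" "\<And>b. b \<in> carrier B \<Longrightarrow> nrm A (T b) \<le> M * nrm B b"
    using T_bound by blast
  have "nrm A (\<ominus>\<^bsub>A\<^esub> T b) + nrm B b \<le> (M + 1) * nrm B b" if "b \<in> carrier B" for b
    using M(2)[OF that] by (simp add: nrm_uminus_A T_closed that distrib_right)
  then show ?thesis
    unfolding bounded_op_def linear_op_def
    by (auto simp: T_Lau_def T_closed T_add T_smult A.minus_add smult_minus_A
        intro!: exI[of _ "M + 1"])
qed

lemma bounded_op_snd: "bounded_op (T_Lau A B T) B snd"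
  unfolding bounded_op_def linear_op_def
  by (auto simp: T_Lau_def A.nrm_nonneg intro!: exI[of _ 1])

end

theorem theorem2p4:
  fixes A :: "('k::{real_normed_field,banach}, 'a) normed_space"
    and B :: "('k, 'b) normed_space"
    and C :: "('k, 'c) normed_space"
    and T :: "'b \<Rightarrow> 'a"
  assumes "banach_algebra A" and "banach_algebra B" and "banach_algebra C"
    and "algebra_hom B A T" and "bounded_op B A T" and "op_norm B A T \<le> 1"
  shows
    "(\<forall>act :: 'c \<Rightarrow> 'a \<Rightarrow> 'a.
        left_banach_module C A act \<longrightarrow>
        injective_module TYPE('u) C (T_Lau A B T)
          (\<lambda>c (a, b). (act c a \<oplus>\<^bsub>A\<^esub> act c (T b), \<zero>\<^bsub>B\<^esub>)) \<longrightarrow>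
        injective_module TYPE('u) C A act) \<and>
     (\<forall>act :: 'c \<Rightarrow> 'b \<Rightarrow> 'b.
        left_banach_module C B act \<longrightarrow>
        injective_module TYPE('u) C (T_Lau A B T)
          (\<lambda>c (a, b). (\<ominus>\<^bsub>A\<^esub> T (act c b), act c b)) \<longrightarrow>
        injective_module TYPE('u) C B act)"
proof (intro conjI allI impI)
  have A: "banach_space A" and B: "banach_space B"
    using assms(1,2) by (auto simp: banach_algebra_def)
  interpret A: banach_space A by (rule A)
  interpret B: banach_space B by (rule B)
  note ABT = A B assms(5)
  note T_closed = T_closed[OF ABT]
  have carrier_L: "carrier (T_Lau A B T) = carrier A \<times> carrier B"
    by (simp add: T_Lau_def)
  {
    fix act :: "'c \<Rightarrow> 'a \<Rightarrow> 'a"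
    let ?act = "\<lambda>c (a, b). (act c a \<oplus>\<^bsub>A\<^esub> act c (T b), \<zero>\<^bsub>B\<^esub>)"
    assume K: "left_banach_module C A act"
      and L: "injective_module TYPE('u) C (T_Lau A B T) ?act"
    have L': "left_banach_module C (T_Lau A B T) ?act"
      using L unfolding injective_module_def by blast
    have act_add: "act c (x \<oplus>\<^bsub>A\<^esub> y) = act c x \<oplus>\<^bsub>A\<^esub> act c y"
      if "c \<in> carrier C" "x \<in> carrier A" "y \<in> carrier A" for c x y
      using left_banach_module.act_bilinear[OF K] that
      unfolding bilinear_op_def linear_op_def by blast
    have T_zero: "T \<zero>\<^bsub>B\<^esub> = \<zero>\<^bsub>A\<^esub>"
      using T_add[OF ABT, of "\<zero>\<^bsub>B\<^esub>" "\<zero>\<^bsub>B\<^esub>"] T_closed[of "\<zero>\<^bsub>B\<^esub>"] by simp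
    have act_zero: "act c \<zero>\<^bsub>A\<^esub> = \<zero>\<^bsub>A\<^esub>" if "c \<in> carrier C" for c
      using act_add[OF that, of "\<zero>\<^bsub>A\<^esub>" "\<zero>\<^bsub>A\<^esub>"]
        left_banach_module_act_closed[OF K that, of "\<zero>\<^bsub>A\<^esub>"] by simp
    note act_closed = left_banach_module_act_closed[OF K]
    have i: "(\<lambda>a\<in>carrier A. (a, \<zero>\<^bsub>B\<^esub>)) \<in> module_ops C A act (T_Lau A B T) ?act"
      by (rule restrict_in_module_ops[OF K bounded_op_fst_inclusion[OF ABT]])
        (simp add: T_zero act_zero act_closed)
    have p: "(\<lambda>(a, b)\<in>carrier (T_Lau A B T). a \<oplus>\<^bsub>A\<^esub> T b)
        \<in> module_ops C (T_Lau A B T) ?act A act"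
      by (rule restrict_in_module_ops[OF L' bounded_op_sheared_fst[OF ABT]])
        (auto simp: carrier_L T_zero T_closed act_add act_closed)
    show "injective_module TYPE('u) C A act"
      by (rule injective_module_retract[OF L K i p]) (simp add: carrier_L T_zero)
  next
    fix act :: "'c \<Rightarrow> 'b \<Rightarrow> 'b"
    let ?act = "\<lambda>c (a, b). (\<ominus>\<^bsub>A\<^esub> T (act c b), act c b)"
    assume K: "left_banach_module C B act"
      and L: "injective_module TYPE('u) C (T_Lau A B T) ?act"
    have L': "left_banach_module C (T_Lau A B T) ?act"
      using L unfolding injective_module_def by blast
    have i: "(\<lambda>b\<in>carrier B. (\<ominus>\<^bsub>A\<^esub> T b, b)) \<in> module_ops C B act (T_Lau A B T) ?act"
      by (rule restrict_in_module_ops[OF K bounded_op_sheared_snd_inclusion[OF ABT]]) simp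
    have p: "restrict snd (carrier (T_Lau A B T)) \<in> module_ops C (T_Lau A B T) ?act B act"
      by (rule restrict_in_module_ops[OF L' bounded_op_snd[OF ABT]]) auto
    show "injective_module TYPE('u) C B act"
      by (rule injective_module_retract[OF L K i p]) (simp add: carrier_L T_closed)
  }
qed

end
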